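(* Let $A$ be a finite alphabet with at least two letters and let $r\geq 1$. Then for every sufficiently large dimension $n$ there is a collection $\mathscr{L}$ of combinatorial lines in $A^n$ containing neither tripods nor triangles such that for every colouring of $A^n$ with $r$ colours some line in $\mathscr{L}$ is monochromatic (i.e. the hypergraph on $A^n$ with edge set $\mathscr{L}$ has chromatic number greater than $r$).
   Context: A combinatorial line in $A^n$ is a set $L=\{\eta(a)\colon a\in A\}$ where, for some partition $[n]=C\cup M_L$ with $C\cap M_L=\emptyset$, $M_L\neq\emptyset$, and some function $g\colon C\to A$, the point $\eta(a)$ has $i$-th coordinate $g(i)$ for $i\in C$ and $a$ for $i\in M_L$; since $|A|\ge 2$ the set $M_L$ (the moving coordinates of $L$) is determined by $L$. Three distinct combinatorial lines form a triangle if any two of them intersect but they do not all pass through a common point. Three distinct combinatorial lines $L,L',L''$ passing through a common point form a tripod if $M_L$ is the disjoint union of $M_{L'}$ and $M_{L''}$. *)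

theory Defs
  imports Main
begin

definition cube :: "'a set \<Rightarrow> nat \<Rightarrow> 'a list set" where
  "cube A n = {xs. length xs = n \<and> set xs \<subseteq> A}"

text \<open>A template for a combinatorial line: a word over (A + a wildcard None),
  None marking the moving coordinates, Some (g i) the constant ones.\<close>
definition is_template :: "'a set \<Rightarrow> nat \<Rightarrow> 'a option list \<Rightarrow> bool" where
  "is_template A n w \<longleftrightarrow> length w = n \<and> set w \<subseteq> insert None (Some ` A) \<and> None \<in> set w"

definition eta :: "'a option list \<Rightarrow> 'a \<Rightarrow> 'a list" where
  "eta w a = map (\<lambda>z. case z of None \<Rightarrow> a | Some b \<Rightarrow> b) w"

definition line_of :: "'a set \<Rightarrow> 'a option list \<Rightarrow> 'a list set" where
  "line_of A w = eta w ` A"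

definition moving :: "'a option list \<Rightarrow> nat set" where
  "moving w = {i. i < length w \<and> w ! i = None}"

definition comb_line :: "'a set \<Rightarrow> nat \<Rightarrow> 'a list set \<Rightarrow> bool" where
  "comb_line A n L \<longleftrightarrow> (\<exists>w. is_template A n w \<and> L = line_of A w)"

definition triangle :: "'a list set \<Rightarrow> 'a list set \<Rightarrow> 'a list set \<Rightarrow> bool" where
  "triangle L L' L'' \<longleftrightarrow> L \<noteq> L' \<and> L \<noteq> L'' \<and> L' \<noteq> L''
     \<and> L \<inter> L' \<noteq> {} \<and> L \<inter> L'' \<noteq> {} \<and> L' \<inter> L'' \<noteq> {} \<and> L \<inter> L' \<inter> L'' = {}"

definition tripod :: "'a set \<Rightarrow> nat \<Rightarrow> 'a list set \<Rightarrow> 'a list set \<Rightarrow> 'a list set \<Rightarrow> bool" where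
  "tripod A n L L' L'' \<longleftrightarrow> L \<noteq> L' \<and> L \<noteq> L'' \<and> L' \<noteq> L'' \<and> L \<inter> L' \<inter> L'' \<noteq> {}
     \<and> (\<exists>w w' w''. is_template A n w \<and> is_template A n w' \<and> is_template A n w''
        \<and> L = line_of A w \<and> L' = line_of A w' \<and> L'' = line_of A w''
        \<and> moving w = moving w' \<union> moving w'' \<and> moving w' \<inter> moving w'' = {})"

end

theory Submission
  imports Defs "HOL-Library.FuncSet"
begin

text \<open>
  Call a family of sets sum-free if none of its members is the disjoint union of two others. Three
  lines forming a tripod or a triangle always have moving sets violating sum-freeness, so it
  suffices to find a family of lines with sum-free moving sets that still has the
  Hales--Jewett property for \<open>r\<close> colours.

  Let \<open>N\<close> be a Hales--Jewett dimension for \<open>A\<close> and \<open>r\<close>. Append to \<open>A\<^sup>N\<close> one block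
  of new coordinates for every \<open>U \<subseteq> {..<N}\<close>, of rapidly growing size. Applying the Hales--Jewett
  theorem to one block after the other, starting with the largest, one finds a line in each block
  such that, on the product of \<open>A\<^sup>N\<close> with these lines, the colour depends on the \<open>A\<^sup>N\<close>-component
  only. A monochromatic line of the resulting colouring of \<open>A\<^sup>N\<close>, with moving set \<open>U\<close>, is then
  extended by the line in block \<open>U\<close> and by constants in all other blocks. In this family the
  moving set outside \<open>{..<N}\<close> is non-empty and determines \<open>U\<close>, hence in a disjoint
  union of two moving sets all three restrictions to \<open>{..<N}\<close> would be the same non-empty set.
\<close>

section \<open>Templates and lines\<close>

lemma eta_append [simp]: "eta (v @ w) a = eta v a @ eta w a"
  by (simp add: eta_def)

lemma eta_map_Some [simp]: "eta (map Some x) a = x"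
  by (simp add: eta_def comp_def)

lemma length_eta [simp]: "length (eta w a) = length w"
  by (simp add: eta_def)

lemma eta_nth: "i < length w \<Longrightarrow> eta w a ! i = (case w ! i of None \<Rightarrow> a | Some b \<Rightarrow> b)"
  by (simp add: eta_def)

lemma eta_in_cube: "is_template A n w \<Longrightarrow> a \<in> A \<Longrightarrow> eta w a \<in> cube A n"
  by (fastforce simp: is_template_def cube_def eta_def split: option.splits)

lemma cube_append: "x \<in> cube A m \<Longrightarrow> y \<in> cube A n \<Longrightarrow> x @ y \<in> cube A (m + n)"
  by (auto simp: cube_def)

lemma cube_mono: "A \<subseteq> B \<Longrightarrow> cube A n \<subseteq> cube B n"
  by (auto simp: cube_def)

lemma finite_cube: "finite A \<Longrightarrow> finite (cube A n)"
  using finite_lists_length_eq[of A n] by (simp add: cube_def conj_commute)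

lemma template_append: "is_template A m v \<Longrightarrow> is_template A n w \<Longrightarrow> is_template A (m + n) (v @ w)"
  by (auto simp: is_template_def)

lemma template_append_const:
  "is_template A m v \<Longrightarrow> x \<in> cube A n \<Longrightarrow> is_template A (m + n) (v @ map Some x)"
  by (auto simp: is_template_def cube_def)

lemma template_const_append:
  "x \<in> cube A m \<Longrightarrow> is_template A n w \<Longrightarrow> is_template A (m + n) (map Some x @ w)"
  by (auto simp: is_template_def cube_def)

lemma template_mono: "is_template A n w \<Longrightarrow> A \<subseteq> B \<Longrightarrow> is_template B n w"
  unfolding is_template_def by blast

lemma moving_nonempty: "is_template A n w \<Longrightarrow> moving w \<noteq> {}"
  by (auto simp: is_template_def moving_def in_set_conv_nth)

lemma moving_map_Some [simp]: "moving (map Some x) = {}"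
  by (auto simp: moving_def)

lemma moving_append: "moving (v @ w) = moving v \<union> (+) (length v) ` moving w"
proof (rule set_eqI)
  fix i
  show "i \<in> moving (v @ w) \<longleftrightarrow> i \<in> moving v \<union> (+) (length v) ` moving w"
  proof (cases "i < length v")
    case False
    then obtain j where "i = length v + j"
      using le_Suc_ex not_less by blast
    then show ?thesis
      by (auto simp: moving_def nth_append)
  qed (auto simp: moving_def nth_append)
qed

lemma moving_less: "i \<in> moving w \<Longrightarrow> i < length w"
  by (simp add: moving_def)

text \<open>A coordinate moves exactly if two points of the line differ there, which mentions only
  the point set. Hence the choice of templates in \<open>tripod\<close> is immaterial.\<close>

lemma moving_determined_by_line:
  assumes "a \<in> A" "b \<in> A" "a \<noteq> b" "length w = length w'" "line_of A w = line_of A w'"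
  shows "moving w = moving w'"
proof -
  have "moving v = {i. i < length v \<and> (\<exists>x\<in>line_of A v. \<exists>y\<in>line_of A v. x ! i \<noteq> y ! i)}" for v
    using assms(1-3) by (fastforce simp: moving_def line_of_def eta_nth split: option.splits)
  from this[of w] this[of w'] show ?thesis
    using assms(4,5) by simp
qed

section \<open>Moving sets of lines in a triangle\<close>

text \<open>Comparing the three meeting points coordinatewise shows that no coordinate moves in
  exactly one line or in all three, and that some pair of lines never moves together. The moving set
  of the third line is then the disjoint union of the moving sets of that pair.\<close>

lemma triangle_moving:
  assumes len: "length w = n" "length w' = n" "length w'' = n"
    and tri: "triangle (line_of A w) (line_of A w') (line_of A w'')"
  shows "(moving w = moving w' \<union> moving w'' \<and> moving w' \<inter> moving w'' = {})
    \<or> (moving w' = moving w \<union> moving w'' \<and> moving w \<inter> moving w'' = {})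
    \<or> (moving w'' = moving w \<union> moving w' \<and> moving w \<inter> moving w' = {})"
proof -
  obtain a a' where a: "a \<in> A" "a' \<in> A" "eta w a = eta w' a'"
    using tri by (auto simp: triangle_def line_of_def)
  obtain b b'' where b: "b \<in> A" "b'' \<in> A" "eta w b = eta w'' b''"
    using tri by (auto simp: triangle_def line_of_def)
  obtain c' c'' where c: "c' \<in> A" "c'' \<in> A" "eta w' c' = eta w'' c''"
    using tri by (auto simp: triangle_def line_of_def)
  have nocommon: "\<not> (x \<in> line_of A w \<and> x \<in> line_of A w' \<and> x \<in> line_of A w'')" for x
    using tri by (auto simp: triangle_def)
  \<comment> \<open>Equal meeting letters on one line would give a point common to all three
    lines.\<close>
  have neq: "a \<noteq> b" "a' \<noteq> c'" "b'' \<noteq> c''"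
    using nocommon[of "eta w a"] nocommon[of "eta w' a'"] nocommon[of "eta w'' b''"] a b c
    unfolding line_of_def by (metis imageI)+
  let ?v = "\<lambda>z x. case z of None \<Rightarrow> x | Some y \<Rightarrow> y"
  have val: "?v (w ! i) a = ?v (w' ! i) a'" "?v (w ! i) b = ?v (w'' ! i) b''"
      "?v (w' ! i) c' = ?v (w'' ! i) c''" if "i < n" for i
    using that len a(3) b(3) c(3) eta_nth by metis+
  have all: "a = a' \<and> b = b'' \<and> c' = c''"
    if "i < n" "w ! i = None" "w' ! i = None" "w'' ! i = None" for i
    using val[of i] that by simp
  have X: "a = a' \<and> b = c'"
    if "i < n" "w ! i = None" "w' ! i = None" "w'' ! i \<noteq> None" for i
    using val[of i] that by (auto split: option.splits)
  have Y: "b = b'' \<and> a = c''"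
    if "i < n" "w ! i = None" "w' ! i \<noteq> None" "w'' ! i = None" for i
    using val[of i] that by (auto split: option.splits)
  have Z: "c' = c'' \<and> a' = b''"
    if "i < n" "w ! i \<noteq> None" "w' ! i = None" "w'' ! i = None" for i
    using val[of i] that by (auto split: option.splits)
  \<comment> \<open>If only one line moves, the meeting point of the other two makes their constants
    agree, but these constants are the two distinct meeting letters of the moving line.\<close>
  have single: "\<not> (w ! i = None \<and> w' ! i \<noteq> None \<and> w'' ! i \<noteq> None)"
      "\<not> (w ! i \<noteq> None \<and> w' ! i = None \<and> w'' ! i \<noteq> None)"
      "\<not> (w ! i \<noteq> None \<and> w' ! i \<noteq> None \<and> w'' ! i = None)" if "i < n" for i
    using val[OF that] neq by (auto split: option.splits)
  show ?thesis
  proof (cases "\<exists>i<n. w ! i = None \<and> w' ! i = None \<and> w'' ! i = None")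
    case True
    then have eqs: "a = a'" "b = b''" "c' = c''"
      using all by blast+
    \<comment> \<open>If only one of \<open>w\<close>, \<open>w'\<close> moves at \<open>i\<close>,
      then \<open>w''\<close> moves as well by \<open>single\<close>, and \<open>Y\<close> or
      \<open>Z\<close> with \<open>eqs\<close> contradicts \<open>neq\<close>.\<close>
    have "w ! i = w' ! i" if "i < n" for i
    proof (cases "w ! i = None \<or> w' ! i = None")
      case True
      then show ?thesis
        using X[OF that] Y[OF that] Z[OF that] single[OF that] eqs neq by metis
    next
      case False
      then show ?thesis
        using val(1)[OF that] by auto
    qed
    then have "w = w'"
      using len by (simp add: nth_equalityI)
    then show ?thesis
      using tri by (simp add: triangle_def)
  next
    case False
    have M: "moving w = {i. i < n \<and> w ! i = None}" "moving w' = {i. i < n \<and> w' ! i = None}"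
        "moving w'' = {i. i < n \<and> w'' ! i = None}"
      using len by (simp_all add: moving_def)
    \<comment> \<open>If all three kinds of coordinate occurred, \<open>X\<close>, \<open>Y\<close>
      and \<open>Z\<close> would give \<open>a = a' = b'' = b\<close>.\<close>
    consider "\<forall>i<n. \<not> (w ! i = None \<and> w' ! i = None \<and> w'' ! i \<noteq> None)"
      | "\<forall>i<n. \<not> (w ! i = None \<and> w' ! i \<noteq> None \<and> w'' ! i = None)"
      | "\<forall>i<n. \<not> (w ! i \<noteq> None \<and> w' ! i = None \<and> w'' ! i = None)"
      using X Y Z neq by metis
    then show ?thesis
    proof cases
      case 1
      then have "moving w'' = moving w \<union> moving w' \<and> moving w \<inter> moving w' = {}"
        unfolding M using single False by blast
      then show ?thesis by blast
    next
      case 2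
      then have "moving w' = moving w \<union> moving w'' \<and> moving w \<inter> moving w'' = {}"
        unfolding M using single False by blast
      then show ?thesis by blast
    next
      case 3
      then have "moving w = moving w' \<union> moving w'' \<and> moving w' \<inter> moving w'' = {}"
        unfolding M using single False by blast
      then show ?thesis by blast
    qed
  qed
qed

section \<open>The Hales--Jewett theorem\<close>

definition HJ_dim :: "'a set \<Rightarrow> nat \<Rightarrow> nat \<Rightarrow> bool" where
  "HJ_dim A r n \<longleftrightarrow> (\<forall>c :: 'a list \<Rightarrow> nat. (\<forall>x\<in>cube A n. c x < r) \<longrightarrow>
     (\<exists>w. is_template A n w \<and> (\<exists>k. \<forall>a\<in>A. c (eta w a) = k)))"

lemma HJ_dim_finite_colours:
  fixes c :: "'a list \<Rightarrow> 'c"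
  assumes "HJ_dim A (card F) n" "finite F" "\<And>x. x \<in> cube A n \<Longrightarrow> c x \<in> F"
  obtains w where "is_template A n w" "\<And>a b. a \<in> A \<Longrightarrow> b \<in> A \<Longrightarrow> c (eta w a) = c (eta w b)"
proof -
  obtain f where f: "bij_betw f F {..<card F}"
    using ex_bij_betw_finite_nat[OF assms(2)] by (auto simp: atLeast0LessThan)
  have "\<forall>x\<in>cube A n. (f \<circ> c) x < card F"
    using assms(3) f by (auto simp: bij_betw_def)
  then obtain w k where w: "is_template A n w" "\<forall>a\<in>A. f (c (eta w a)) = k"
    using assms(1)[unfolded HJ_dim_def, rule_format, of "f \<circ> c"] by auto
  have "c (eta w a) = c (eta w b)" if "a \<in> A" "b \<in> A" for a b
    using f w that assms(3) eta_in_cube[OF w(1)] unfolding bij_betw_def inj_on_def by metis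
  with w(1) show ?thesis
    by (rule that)
qed

text \<open>Colouring \<open>y\<close> by the whole function sending \<open>x\<close> to
  \<open>c x y\<close> yields one line that works for every \<open>x\<close> in \<open>S\<close>
  simultaneously; its colour may still depend on \<open>x\<close>.\<close>

lemma HJ_dim_product:
  assumes "HJ_dim A (card (S \<rightarrow>\<^sub>E {..<r})) n" "finite S"
    and col: "\<And>x y. x \<in> S \<Longrightarrow> y \<in> cube A n \<Longrightarrow> (c :: 'b \<Rightarrow> 'a list \<Rightarrow> nat) x y < r"
  obtains w where "is_template A n w"
    "\<And>a b x. a \<in> A \<Longrightarrow> b \<in> A \<Longrightarrow> x \<in> S \<Longrightarrow> c x (eta w a) = c x (eta w b)"
proof -
  have "(\<lambda>x\<in>S. c x y) \<in> S \<rightarrow>\<^sub>E {..<r}" if "y \<in> cube A n" for y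
    using col that by auto
  then obtain w where w: "is_template A n w"
    "\<And>a b. a \<in> A \<Longrightarrow> b \<in> A \<Longrightarrow> (\<lambda>x\<in>S. c x (eta w a)) = (\<lambda>x\<in>S. c x (eta w b))"
    using HJ_dim_finite_colours[OF assms(1) finite_PiE[OF assms(2)], of "\<lambda>y. \<lambda>x\<in>S. c x y"] by blast
  show ?thesis
    using w(1) by (rule that) (use w(2) in \<open>metis restrict_apply'\<close>)
qed

section \<open>Colour focusing\<close>

text \<open>The colour-focused lines of the standard proof of the Hales--Jewett theorem, with focus
  \<open>x\<close> reached at the letter \<open>z\<close>. Indexing the lines by their colours turns
  distinctness of the colours into \<open>card K = s\<close>.\<close>

definition focused :: "'a set \<Rightarrow> 'a \<Rightarrow> nat \<Rightarrow> nat \<Rightarrow> nat \<Rightarrow> ('a list \<Rightarrow> nat) \<Rightarrow> bool" where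
  "focused A z r s n c \<longleftrightarrow> (\<exists>x\<in>cube (insert z A) n. \<exists>K\<subseteq>{..<r}. card K = s \<and>
     (\<forall>k\<in>K. \<exists>w. is_template (insert z A) n w \<and> eta w z = x \<and> (\<forall>a\<in>A. c (eta w a) = k)))"

text \<open>Each step of the induction on \<open>s\<close> prepends coordinates carrying a line on
  which the letters of \<open>A\<close> are indistinguishable, whatever the old coordinates are. If
  the old focus has a colour in \<open>K\<close>, a monochromatic line arises; otherwise one more
  focused line does.\<close>

lemma colour_focusing:
  assumes "finite A" "A \<noteq> {}" and HJ: "\<And>r. \<exists>n. HJ_dim A r n"
  shows "\<exists>n. \<forall>c. (\<forall>x\<in>cube (insert z A) n. c x < r) \<longrightarrow>
    (\<exists>w. is_template (insert z A) n w \<and> (\<exists>k. \<forall>a\<in>insert z A. c (eta w a) = k))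
    \<or> focused A z r s n c"
proof (induction s)
  case 0
  show ?case
    by (rule exI[of _ 0]) (auto simp: focused_def cube_def)
next
  case (Suc s)
  let ?B = "insert z A"
  obtain a0 where a0: "a0 \<in> A"
    using assms(2) by blast
  obtain n where n: "\<And>c. \<forall>x\<in>cube ?B n. c x < r \<Longrightarrow>
    (\<exists>w. is_template ?B n w \<and> (\<exists>k. \<forall>a\<in>?B. c (eta w a) = k)) \<or> focused A z r s n c"
    using Suc.IH by blast
  obtain m where m: "HJ_dim A (card (cube ?B n \<rightarrow>\<^sub>E {..<r})) m"
    using HJ by blast
  show ?case
  proof (intro exI[of _ "m + n"] allI impI)
    fix c :: "'a list \<Rightarrow> nat"
    assume c: "\<forall>x\<in>cube ?B (m + n). c x < r"
    have sub: "cube A m \<subseteq> cube ?B m"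
      by (rule cube_mono) auto
    have fin: "finite (cube ?B n)"
      using assms(1) by (intro finite_cube) simp
    obtain v where v: "is_template A m v"
      and vc: "\<And>a b x. a \<in> A \<Longrightarrow> b \<in> A \<Longrightarrow> x \<in> cube ?B n \<Longrightarrow> c (eta v a @ x) = c (eta v b @ x)"
      using HJ_dim_product[OF m fin, of "\<lambda>x y. c (y @ x)"] c cube_append sub by blast
    have vB: "is_template ?B m v"
      using v template_mono by blast
    define y where "y = eta v a0"
    have y: "y \<in> cube ?B m"
      unfolding y_def using eta_in_cube[OF vB] a0 by blast
    have "\<forall>x\<in>cube ?B n. c (y @ x) < r"
      using c y cube_append by blast
    from n[OF this] consider
      (mono) w k where "is_template ?B n w" "\<forall>a\<in>?B. c (y @ eta w a) = k"
      | (foc) "focused A z r s n (\<lambda>x. c (y @ x))"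
      by blast
    then show "(\<exists>w. is_template ?B (m + n) w \<and> (\<exists>k. \<forall>a\<in>?B. c (eta w a) = k))
      \<or> focused A z r (Suc s) (m + n) c"
    proof cases
      case mono
      then have "is_template ?B (m + n) (map Some y @ w)"
        "\<forall>a\<in>?B. c (eta (map Some y @ w) a) = k"
        using template_const_append[OF y] by auto
      then show ?thesis by blast
    next
      case foc
      then obtain x K where x: "x \<in> cube ?B n" and K: "K \<subseteq> {..<r}" "card K = s"
        and lines: "\<And>k. k \<in> K \<Longrightarrow> \<exists>w. is_template ?B n w \<and> eta w z = x \<and>
          (\<forall>a\<in>A. c (y @ eta w a) = k)"
        unfolding focused_def by auto
      show ?thesis
      proof (cases "c (y @ x) \<in> K")
        case True
        then obtain w where w: "is_template ?B n w" "eta w z = x"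
          "\<forall>a\<in>A. c (y @ eta w a) = c (y @ x)"
          using lines by blast
        then have "is_template ?B (m + n) (map Some y @ w)"
          "\<forall>a\<in>?B. c (eta (map Some y @ w) a) = c (y @ x)"
          using template_const_append[OF y] by auto
        then show ?thesis by blast
      next
        case False
        \<comment> \<open>The new focus takes \<open>z\<close> in the prepended part as well. The
          old lines are extended diagonally by \<open>v\<close>, and the extra colour comes from
          moving along \<open>v\<close> with \<open>x\<close> fixed.\<close>
        let ?x = "eta v z @ x" and ?K = "insert (c (y @ x)) K"
        have "?x \<in> cube ?B (m + n)"
          using eta_in_cube[OF vB] x cube_append by blast
        moreover have "?K \<subseteq> {..<r}"
          using K c cube_append[OF y x] by auto
        moreover have "card ?K = Suc s"
          using False K finite_subset by fastforce
        moreover have "\<exists>w. is_template ?B (m + n) w \<and> eta w z = ?x \<and> (\<forall>a\<in>A. c (eta w a) = k)"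
          if k: "k \<in> ?K" for k
        proof (cases "k = c (y @ x)")
          case True
          have "is_template ?B (m + n) (v @ map Some x)"
            using template_append_const[OF vB x] .
          moreover have "\<forall>a\<in>A. c (eta (v @ map Some x) a) = k"
            using vc[OF _ a0 x] True by (simp add: y_def)
          ultimately show ?thesis
            by (intro exI[of _ "v @ map Some x"]) simp
        next
          case False
          then obtain w where w: "is_template ?B n w" "eta w z = x" "\<forall>a\<in>A. c (y @ eta w a) = k"
            using lines k by blast
          \<comment> \<open>On the diagonal line, \<open>vc\<close> resets the prefix to
            \<open>y\<close> without changing the colour.\<close>
          have "c (eta v a @ eta w a) = k" if "a \<in> A" for a
            using vc[OF that a0 eta_in_cube[OF w(1)], of a] that w(3) by (simp add: y_def)
          then show ?thesis
            using template_append[OF vB w(1)] w(2) by (intro exI[of _ "v @ w"]) simp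
        qed
        ultimately have "focused A z r (Suc s) (m + n) c"
          unfolding focused_def by blast
        then show ?thesis ..
      qed
    qed
  qed
qed

theorem Hales_Jewett:
  assumes "finite A"
  shows "\<exists>n. HJ_dim A r n"
  using assms
proof (induction A arbitrary: r)
  case empty
  have "is_template {} 1 [None]"
    by (simp add: is_template_def)
  then show ?case
    unfolding HJ_dim_def by blast
next
  case (insert z A)
  show ?case
  proof (cases "A = {}")
    case True
    \<comment> \<open>Focusing needs a letter in \<open>A\<close> for its base point, so the
      one-letter alphabet, whose lines are single points, is treated directly.\<close>
    have "is_template {z} 1 [None]"
      by (simp add: is_template_def)
    then show ?thesis
      using True unfolding HJ_dim_def by blast
  next
    case False
    \<comment> \<open>With \<open>s = r\<close> the focused lines exhaust all colours, so the focus
      shares its colour with one of them.\<close>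
    obtain n where n: "\<And>c. \<forall>x\<in>cube (insert z A) n. c x < r \<Longrightarrow>
      (\<exists>w. is_template (insert z A) n w \<and> (\<exists>k. \<forall>a\<in>insert z A. c (eta w a) = k))
      \<or> focused A z r r n c"
      using colour_focusing[OF insert.hyps(1) False insert.IH, of z r r] by blast
    have "\<exists>w. is_template (insert z A) n w \<and> (\<exists>k. \<forall>a\<in>insert z A. c (eta w a) = k)"
      if c: "\<forall>x\<in>cube (insert z A) n. c x < r" for c
      using n[OF c]
    proof
      assume "focused A z r r n c"
      then obtain x K where x: "x \<in> cube (insert z A) n" and K: "K \<subseteq> {..<r}" "card K = r"
        and lines: "\<And>k. k \<in> K \<Longrightarrow> \<exists>w. is_template (insert z A) n w \<and> eta w z = x \<and>
          (\<forall>a\<in>A. c (eta w a) = k)"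
        unfolding focused_def by auto
      have "K = {..<r}"
        using K by (simp add: card_subset_eq)
      then show ?thesis
        using lines[of "c x"] c x by auto
    qed
    then show ?thesis
      unfolding HJ_dim_def by blast
  qed
qed

section \<open>Blocks of coordinates\<close>

text \<open>The function \<open>\<tau>\<close> labels the appended coordinates by the block they belong to.\<close>

lemma block_extension:
  fixes A :: "'a set" and r N :: nat
  assumes A: "finite A" "a0 \<in> A" and "finite I"
  shows "\<exists>n. \<exists>\<tau> :: nat \<Rightarrow> 'b. \<forall>c :: 'a list \<Rightarrow> nat. (\<forall>x\<in>cube A (N + n). c x < r) \<longrightarrow>
    (\<exists>x\<in>cube A n. \<forall>U\<in>I. \<exists>v. is_template A n v \<and> \<tau> ` moving v \<subseteq> {U} \<and>
       (\<forall>q\<in>cube A N. \<forall>a\<in>A. c (q @ eta v a) = c (q @ x)))"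
  using assms(3)
proof (induction I)
  case empty
  show ?case
    by (rule exI[of _ 0]) (auto simp: cube_def)
next
  case (insert U0 I)
  then obtain n and \<tau> :: "nat \<Rightarrow> 'b" where IH: "\<And>c :: 'a list \<Rightarrow> nat. \<forall>x\<in>cube A (N + n). c x < r \<Longrightarrow>
    \<exists>x\<in>cube A n. \<forall>U\<in>I. \<exists>v. is_template A n v \<and> \<tau> ` moving v \<subseteq> {U} \<and>
       (\<forall>q\<in>cube A N. \<forall>a\<in>A. c (q @ eta v a) = c (q @ x))"
    by blast
  \<comment> \<open>The new block is chosen against all \<open>r\<close>-colourings of the
    coordinates before it, so it is the first one to be handled once a colouring is given.\<close>
  obtain m where m: "HJ_dim A (card (cube A (N + n) \<rightarrow>\<^sub>E {..<r})) m"
    using Hales_Jewett[OF A(1)] by blast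
  let ?\<tau> = "\<lambda>i. if i < n then \<tau> i else U0"
  show ?case
  proof (intro exI[of _ "n + m"] exI[of _ ?\<tau>] allI impI)
    fix c :: "'a list \<Rightarrow> nat"
    assume c: "\<forall>x\<in>cube A (N + (n + m)). c x < r"
    have c': "c (x @ y) < r" if "x \<in> cube A (N + n)" "y \<in> cube A m" for x y
      using c cube_append[OF that] by (simp add: add.assoc)
    obtain t where t: "is_template A m t"
      and tc: "\<And>a b x. a \<in> A \<Longrightarrow> b \<in> A \<Longrightarrow> x \<in> cube A (N + n) \<Longrightarrow>
        c (x @ eta t a) = c (x @ eta t b)"
      using HJ_dim_product[OF m finite_cube[OF A(1)], of "\<lambda>x y. c (x @ y)"] c' by blast
    define y where "y = eta t a0"
    have y: "y \<in> cube A m"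
      unfolding y_def using eta_in_cube[OF t A(2)] .
    obtain x where x: "x \<in> cube A n" and IHx: "\<And>U. U \<in> I \<Longrightarrow>
      \<exists>v. is_template A n v \<and> \<tau> ` moving v \<subseteq> {U} \<and>
        (\<forall>q\<in>cube A N. \<forall>a\<in>A. c ((q @ eta v a) @ y) = c ((q @ x) @ y))"
    proof -
      \<comment> \<open>Freezing the new block at \<open>y\<close> leaves a colouring of the earlier
        coordinates for the induction hypothesis.\<close>
      have "\<forall>x\<in>cube A (N + n). c (x @ y) < r"
        using c' y by blast
      from IH[OF this] show thesis
        using that by blast
    qed
    show "\<exists>x\<in>cube A (n + m). \<forall>U\<in>insert U0 I. \<exists>v. is_template A (n + m) v \<and>
      ?\<tau> ` moving v \<subseteq> {U} \<and> (\<forall>q\<in>cube A N. \<forall>a\<in>A. c (q @ eta v a) = c (q @ x))"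
    \<comment> \<open>For \<open>U0\<close> the line moves along \<open>t\<close> with
      \<open>x\<close> fixed; for \<open>U\<close> in \<open>I\<close> it moves along the old
      \<open>v\<close> with \<open>y\<close> fixed.\<close>
    proof (intro bexI[of _ "x @ y"] ballI)
      fix U assume "U \<in> insert U0 I"
      then consider "U = U0" | "U \<in> I" by blast
      then show "\<exists>v. is_template A (n + m) v \<and> ?\<tau> ` moving v \<subseteq> {U} \<and>
        (\<forall>q\<in>cube A N. \<forall>a\<in>A. c (q @ eta v a) = c (q @ x @ y))"
      proof cases
        case 1
        have len: "length x = n"
          using x by (simp add: cube_def)
        have "c (q @ eta (map Some x @ t) a) = c (q @ x @ y)" if "q \<in> cube A N" "a \<in> A" for q a
          using tc[OF that(2) A(2) cube_append[OF that(1) x]] by (simp add: y_def)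
        moreover have "?\<tau> ` moving (map Some x @ t) \<subseteq> {U}"
          using 1 len by (auto simp: moving_append)
        ultimately show ?thesis
          using template_const_append[OF x t] by blast
      next
        case 2
        then obtain v where v: "is_template A n v" "\<tau> ` moving v \<subseteq> {U}"
          "\<forall>q\<in>cube A N. \<forall>a\<in>A. c ((q @ eta v a) @ y) = c ((q @ x) @ y)"
          using IHx by blast
        have "length v = n"
          using v(1) by (simp add: is_template_def)
        then have "?\<tau> ` moving (v @ map Some y) \<subseteq> {U}"
          using v(2) by (auto simp: moving_append dest: moving_less)
        then show ?thesis
          using template_append_const[OF v(1) y] v(3) by (intro exI[of _ "v @ map Some y"]) simp
      qed
    qed (use cube_append[OF x y] in simp)
  qed
qed

section \<open>A family of lines with sum-free moving sets\<close>

text \<open>The middle part moves only in the block labelled by the moving set of \<open>u\<close>.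
  The constant tail \<open>p\<close> adjusts the dimension.\<close>

definition block_templates ::
    "'a set \<Rightarrow> nat \<Rightarrow> nat \<Rightarrow> (nat \<Rightarrow> nat set) \<Rightarrow> 'a list \<Rightarrow> 'a option list set" where
  "block_templates A N n \<tau> p = {u @ v @ map Some p |u v.
     is_template A N u \<and> is_template A n v \<and> \<tau> ` moving v \<subseteq> {moving u}}"

text \<open>The label of any moving coordinate from position \<open>N\<close> on recovers the trace
  \<open>?U w\<close>. Both summands of a union have such a coordinate, and it moves in the union
  too, so all three traces agree; but a non-empty set is not disjoint from itself.\<close>

lemma block_templates_sum_free:
  assumes "w \<in> block_templates A N n \<tau> p" "w' \<in> block_templates A N n \<tau> p"
    "w'' \<in> block_templates A N n \<tau> p"
  shows "\<not> (moving w = moving w' \<union> moving w'' \<and> moving w' \<inter> moving w'' = {})"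
proof -
  let ?U = "\<lambda>w. moving w \<inter> {..<N}"
  have *: "?U w \<noteq> {} \<and> (\<exists>i\<ge>N. i \<in> moving w) \<and> (\<forall>i\<in>moving w. i \<ge> N \<longrightarrow> \<tau> (i - N) = ?U w)"
    if w: "w \<in> block_templates A N n \<tau> p" for w
  proof -
    obtain u v where uv: "w = u @ v @ map Some p" "is_template A N u" "is_template A n v"
      "\<tau> ` moving v \<subseteq> {moving u}"
      using w unfolding block_templates_def by blast
    have len: "length u = N"
      using uv(2) by (simp add: is_template_def)
    have M: "moving w = moving u \<union> (+) N ` moving v"
      using uv(1) len by (simp add: moving_append)
    have less: "moving u \<subseteq> {..<N}"
      using len by (auto dest: moving_less)
    have U: "?U w = moving u"
      using M less by auto
    obtain j where "j \<in> moving v"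
      using moving_nonempty[OF uv(3)] by blast
    then have "N \<le> N + j \<and> N + j \<in> moving w"
      using M by simp
    then have "\<exists>i\<ge>N. i \<in> moving w"
      by blast
    moreover have "\<tau> (i - N) = moving u" if i: "i \<in> moving w" "i \<ge> N" for i
    proof -
      have "i \<notin> moving u"
        using less i(2) by auto
      then obtain j where "j \<in> moving v" "i = N + j"
        using i(1) M by auto
      then show ?thesis
        using uv(4) by auto
    qed
    ultimately show ?thesis
      using moving_nonempty[OF uv(2)] unfolding U by simp
  qed
  show ?thesis
  proof
    assume sum: "moving w = moving w' \<union> moving w'' \<and> moving w' \<inter> moving w'' = {}"
    obtain i' where "i' \<ge> N" "i' \<in> moving w'"
      using *[OF assms(2)] by blast
    then have "?U w' = ?U w"
      using *[OF assms(1)] *[OF assms(2)] sum by (metis UnI1)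
    moreover obtain i'' where "i'' \<ge> N" "i'' \<in> moving w''"
      using *[OF assms(3)] by blast
    then have "?U w'' = ?U w"
      using *[OF assms(1)] *[OF assms(3)] sum by (metis UnI2)
    moreover have "?U w' \<noteq> {}"
      using *[OF assms(2)] by blast
    ultimately show False
      using sum by blast
  qed
qed

section \<open>Lines without tripods and triangles in all large dimensions\<close>

theorem theorem3p7:
  fixes A :: "'a set" and r :: nat
  assumes "finite A" and "card A \<ge> 2" and "r \<ge> 1"
  shows "\<exists>N. \<forall>n\<ge>N. \<exists>\<L> :: 'a list set set.
           (\<forall>L\<in>\<L>. comb_line A n L)
         \<and> (\<forall>L\<in>\<L>. \<forall>L'\<in>\<L>. \<forall>L''\<in>\<L>. \<not> tripod A n L L' L'')
         \<and> (\<forall>L\<in>\<L>. \<forall>L'\<in>\<L>. \<forall>L''\<in>\<L>. \<not> triangle L L' L'')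
         \<and> (\<forall>c :: 'a list \<Rightarrow> nat. (\<forall>x\<in>cube A n. c x < r) \<longrightarrow>
              (\<exists>L\<in>\<L>. \<exists>k. \<forall>x\<in>L. c x = k))"
proof -
  obtain a0 b0 where ab: "a0 \<in> A" "b0 \<in> A" "a0 \<noteq> b0"
    using assms(2) card_le_Suc0_iff_eq[OF assms(1)] by fastforce
  obtain N where N: "HJ_dim A r N"
    using Hales_Jewett[OF assms(1)] by blast
  \<comment> \<open>Every subset of \<open>{..<N}\<close> gets a block, because the moving set of
    the line found in \<open>cube A N\<close> depends on the colouring while the family must
    not.\<close>
  obtain n and \<tau> :: "nat \<Rightarrow> nat set" where n: "\<forall>c :: 'a list \<Rightarrow> nat. (\<forall>x\<in>cube A (N + n). c x < r) \<longrightarrow>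
    (\<exists>x\<in>cube A n. \<forall>U\<in>Pow {..<N}. \<exists>v. is_template A n v \<and> \<tau> ` moving v \<subseteq> {U} \<and>
       (\<forall>q\<in>cube A N. \<forall>a\<in>A. c (q @ eta v a) = c (q @ x)))"
    using block_extension[OF assms(1) ab(1) finite_Pow_iff[THEN iffD2, OF finite_lessThan[of N]],
        of N r] by (elim exE)
  show ?thesis
  proof (intro exI[of _ "N + n"] allI impI)
    fix n' assume "N + n \<le> n'"
    then obtain k where k: "n' = N + n + k"
      using le_Suc_ex by blast
    \<comment> \<open>Surplus coordinates are frozen, so one construction serves all larger
      dimensions.\<close>
    define p where "p = replicate k a0"
    have p: "p \<in> cube A k"
      using ab(1) by (auto simp: p_def cube_def)
    define W where "W = block_templates A N n \<tau> p"
    have tmpl: "is_template A n' w" if w: "w \<in> W" for w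
    proof -
      obtain u v where "w = u @ v @ map Some p" "is_template A N u" "is_template A n v"
        using w unfolding W_def block_templates_def by blast
      then show ?thesis
        using template_append_const[OF template_append p] k by (metis append_assoc)
    qed
    have sum_free: "\<not> (moving w = moving w' \<union> moving w'' \<and> moving w' \<inter> moving w'' = {})"
      if "w \<in> W" "w' \<in> W" "w'' \<in> W" for w w' w''
      using block_templates_sum_free[OF that[unfolded W_def]] .
    let ?L = "line_of A ` W"
    have lines: "\<forall>L\<in>?L. comb_line A n' L"
      using tmpl by (auto simp: comb_line_def)
    have no_tripod: "\<not> tripod A n' (line_of A w) (line_of A w') (line_of A w'')"
      if W: "w \<in> W" "w' \<in> W" "w'' \<in> W" for w w' w''
    proof
      assume "tripod A n' (line_of A w) (line_of A w') (line_of A w'')"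
      then obtain v v' v'' where v: "is_template A n' v" "is_template A n' v'" "is_template A n' v''"
        "line_of A w = line_of A v" "line_of A w' = line_of A v'" "line_of A w'' = line_of A v''"
        "moving v = moving v' \<union> moving v'' \<and> moving v' \<inter> moving v'' = {}"
        unfolding tripod_def by blast
      \<comment> \<open>The templates witnessing the tripod may differ from those in
        \<open>W\<close>, but their moving sets agree.\<close>
      have "moving w = moving v" "moving w' = moving v'" "moving w'' = moving v''"
        using moving_determined_by_line[OF ab] v(1-6) tmpl W unfolding is_template_def by metis+
      then show False
        using sum_free[OF W] v(7) by simp
    qed
    have no_triangle: "\<not> triangle (line_of A w) (line_of A w') (line_of A w'')"
      if W: "w \<in> W" "w' \<in> W" "w'' \<in> W" for w w' w''
    proof
      assume tri: "triangle (line_of A w) (line_of A w') (line_of A w'')"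
      have "length w = n'" "length w' = n'" "length w'' = n'"
        using tmpl W by (auto simp: is_template_def)
      from triangle_moving[OF this tri] show False
        using sum_free W by blast
    qed
    have mono: "\<exists>L\<in>?L. \<exists>k. \<forall>x\<in>L. c x = k"
      if c: "\<forall>x\<in>cube A n'. c x < r" for c :: "'a list \<Rightarrow> nat"
    proof -
      have c': "\<forall>x\<in>cube A (N + n). c (x @ p) < r"
        using c cube_append[OF _ p] by (simp add: k)
      obtain x where x: "x \<in> cube A n" and ext: "\<forall>U\<in>Pow {..<N}.
        \<exists>v. is_template A n v \<and> \<tau> ` moving v \<subseteq> {U} \<and>
          (\<forall>q\<in>cube A N. \<forall>a\<in>A. c ((q @ eta v a) @ p) = c ((q @ x) @ p))"
        using n[THEN spec, THEN mp, OF c'] by (rule bexE)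
      \<comment> \<open>The reduced colouring freezes all blocks at \<open>x\<close>; the moving set
        of its monochromatic line \<open>u\<close> then selects the block in which \<open>v\<close>
        moves.\<close>
      have "\<forall>q\<in>cube A N. c ((q @ x) @ p) < r"
        using c'[THEN bspec, OF cube_append[OF _ x]] by blast
      from N[unfolded HJ_dim_def, THEN spec, THEN mp, OF this] obtain u j
        where u: "is_template A N u" "\<forall>a\<in>A. c ((eta u a @ x) @ p) = j"
        by blast
      have "moving u \<in> Pow {..<N}"
        using u(1) by (auto simp: is_template_def dest: moving_less)
      from bspec[OF ext this] obtain v where v: "is_template A n v" "\<tau> ` moving v \<subseteq> {moving u}"
        "\<forall>q\<in>cube A N. \<forall>a\<in>A. c ((q @ eta v a) @ p) = c ((q @ x) @ p)"
        by (elim exE conjE)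
      have W: "u @ v @ map Some p \<in> W"
        using u(1) v(1,2) unfolding W_def block_templates_def by blast
      have "\<forall>y\<in>line_of A (u @ v @ map Some p). c y = j"
      proof
        fix y assume y: "y \<in> line_of A (u @ v @ map Some p)"
        obtain a where a: "a \<in> A" "y = (eta u a @ eta v a) @ p"
          using y by (auto simp: line_of_def)
        \<comment> \<open>Since \<open>v\<close> works for every \<open>q\<close> simultaneously,
          \<open>q = eta u a\<close> may vary together with the letter \<open>a\<close> inserted
          into \<open>v\<close>.\<close>
        then have "c y = c ((eta u a @ x) @ p)"
          using v(3)[THEN bspec, OF eta_in_cube[OF u(1) a(1)]] by blast
        then show "c y = j"
          using u(2) a(1) by simp
      qed
      then have "\<exists>k. \<forall>y\<in>line_of A (u @ v @ map Some p). c y = k"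
        by (rule exI)
      then show ?thesis
        using imageI[OF W] by (rule bexI)
    qed
    show "\<exists>\<L> :: 'a list set set.
           (\<forall>L\<in>\<L>. comb_line A n' L)
         \<and> (\<forall>L\<in>\<L>. \<forall>L'\<in>\<L>. \<forall>L''\<in>\<L>. \<not> tripod A n' L L' L'')
         \<and> (\<forall>L\<in>\<L>. \<forall>L'\<in>\<L>. \<forall>L''\<in>\<L>. \<not> triangle L L' L'')
         \<and> (\<forall>c :: 'a list \<Rightarrow> nat. (\<forall>x\<in>cube A n'. c x < r) \<longrightarrow>
              (\<exists>L\<in>\<L>. \<exists>k. \<forall>x\<in>L. c x = k))"
    proof (intro exI[of _ ?L] conjI)
      show "\<forall>L\<in>?L. \<forall>L'\<in>?L. \<forall>L''\<in>?L. \<not> tripod A n' L L' L''"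
        using no_tripod by simp
      show "\<forall>L\<in>?L. \<forall>L'\<in>?L. \<forall>L''\<in>?L. \<not> triangle L L' L''"
        using no_triangle by simp
      show "\<forall>c :: 'a list \<Rightarrow> nat. (\<forall>x\<in>cube A n'. c x < r) \<longrightarrow> (\<exists>L\<in>?L. \<exists>k. \<forall>x\<in>L. c x = k)"
        by (intro allI impI) (rule mono)
    qed (rule lines)
  qed
qed

end
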